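(* A discrete gray scale image $I$ is symmetric with respect to reflections about the line through the origin with direction $(\cos\theta_0,\sin\theta_0)^T$ if and only if $$\tan\big((l-j)\theta_0\big)=-\frac{\mathrm{Im}(\mu_{j,l})}{\mathrm{Re}(\mu_{j,l})},\qquad j,l=0,1,\dots.$$
   Context: A discrete gray scale image $I=\{(z_k,\rho(z_k))\}_{k=1}^N$ consists of $N$ pairwise distinct pixel locations $z_k\in\mathbb{C}$ and a mapping $\rho:\{z_k\}_{k=1}^N\to\mathbb{R}_{\ge 0}$ giving the pixel intensities. The complex moments are $\mu_{j,l}=\sum_{k=1}^N z_k^j\bar z_k^l\rho(z_k)$ for integers $j,l\ge 0$. The angle $\theta_0$ lies in $(-\frac{\pi}{2},\frac{\pi}{2}]$. Reflection about the line through the origin with direction $(\cos\theta_0,\sin\theta_0)^T$ sends $I$ to the image $\{(\bar z_k e^{2i\theta_0},\rho(z_k))\}_{k=1}^N$ (the intensity is carried along); $I$ is symmetric with respect to this reflection if it equals its reflected image.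
   Formalization: Zero-intensity pixels make the "if" part false, so symmetry is taken up to pixels of intensity 0, and literally when all intensities are positive; the tangent equation allows infinite values on both sides and imposes no condition when the moment is 0. *)

theory Defs
  imports Complex_Main
begin

text \<open>An image is its set of pairs (pixel location, intensity).\<close>

definition gray_image :: "nat \<Rightarrow> (nat \<Rightarrow> complex) \<Rightarrow> (complex \<Rightarrow> real) \<Rightarrow> (complex \<times> real) set" where
  "gray_image N z \<rho> = {(z k, \<rho> (z k)) | k. k \<in> {1..N}}"

definition is_gray_image :: "nat \<Rightarrow> (nat \<Rightarrow> complex) \<Rightarrow> (complex \<Rightarrow> real) \<Rightarrow> bool" where
  "is_gray_image N z \<rho> \<longleftrightarrow> inj_on z {1..N} \<and> (\<forall>k\<in>{1..N}. 0 \<le> \<rho> (z k))"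

definition complex_moment ::
    "nat \<Rightarrow> (nat \<Rightarrow> complex) \<Rightarrow> (complex \<Rightarrow> real) \<Rightarrow> nat \<Rightarrow> nat \<Rightarrow> complex" where
  "complex_moment N z \<rho> j l = (\<Sum>k=1..N. z k ^ j * cnj (z k) ^ l * of_real (\<rho> (z k)))"

definition reflect_image :: "real \<Rightarrow> (complex \<times> real) set \<Rightarrow> (complex \<times> real) set" where
  "reflect_image \<theta> I = (\<lambda>(w, r). (cnj w * exp (2 * \<i> * of_real \<theta>), r)) ` I"

definition reflection_symmetric :: "real \<Rightarrow> (complex \<times> real) set \<Rightarrow> bool" where
  "reflection_symmetric \<theta> I \<longleftrightarrow> reflect_image \<theta> I = I"

text \<open>
  Pixels of intensity 0 contribute nothing to any moment, so moments determine an image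
  only up to such pixels: the image with the two pixels (1, 1) and (i, 0) has all moments
  equal to 1, as if it were symmetric about the real axis, but its set of pairs is not
  invariant under conjugation.  Hence symmetry is also considered with black pixels
  identified with the (black) background.
\<close>

definition nonblack :: "(complex \<times> real) set \<Rightarrow> (complex \<times> real) set" where
  "nonblack I = {p \<in> I. snd p \<noteq> 0}"

definition reflection_symmetric_mod_black :: "real \<Rightarrow> (complex \<times> real) set \<Rightarrow> bool" where
  "reflection_symmetric_mod_black \<theta> I \<longleftrightarrow> nonblack (reflect_image \<theta> I) = nonblack I"

lemma reflection_symmetric_imp_mod_black:
  "reflection_symmetric \<theta> I \<Longrightarrow> reflection_symmetric_mod_black \<theta> I"
  by (simp add: reflection_symmetric_def reflection_symmetric_mod_black_def)

lemma reflection_symmetric_mod_black_iff: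
  assumes "\<forall>p\<in>I. snd p \<noteq> 0"
  shows "reflection_symmetric_mod_black \<theta> I \<longleftrightarrow> reflection_symmetric \<theta> I"
proof -
  have "nonblack I = I" "nonblack (reflect_image \<theta> I) = reflect_image \<theta> I"
    using assms by (auto simp: nonblack_def reflect_image_def)
  then show ?thesis
    by (simp add: reflection_symmetric_def reflection_symmetric_mod_black_def)
qed

text \<open>
  The equation \<open>tan \<phi> = p / q\<close>, read in the real numbers with one point at infinity: \<open>p / 0\<close>
  with \<open>p \<noteq> 0\<close> and \<open>tan \<phi>\<close> with \<open>cos \<phi> = 0\<close> are infinite, and the indeterminate \<open>0 / 0\<close> imposes
  no condition.  The HOL conventions \<open>p / 0 = 0\<close> and \<open>tan (pi / 2) = 0\<close> would be wrong here.
\<close>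

definition tan_eq_quotient :: "real \<Rightarrow> real \<Rightarrow> real \<Rightarrow> bool" where
  "tan_eq_quotient \<phi> p q \<longleftrightarrow>
     (if q \<noteq> 0 then cos \<phi> \<noteq> 0 \<and> tan \<phi> = p / q
      else if p \<noteq> 0 then cos \<phi> = 0
      else True)"

lemma tan_eq_quotient_iff: "tan_eq_quotient \<phi> p q \<longleftrightarrow> p * cos \<phi> = q * sin \<phi>"
proof -
  have "cos \<phi> = 0 \<Longrightarrow> sin \<phi> \<noteq> 0"
    using sin_cos_squared_add[of \<phi>] by auto
  then show ?thesis
    by (cases "cos \<phi> = 0") (auto simp: tan_eq_quotient_def tan_def field_simps)
qed

end

theory Submission
  imports Defs "HOL-Computational_Algebra.Polynomial"
begin

text \<open>
  Encode the image by its intensity function on the plane, extended by 0 off the pixels. The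
  tangent condition at \<open>(j, l)\<close> says that \<open>\<mu>\<^sub>j\<^sub>l\<close> times \<open>exp (\<i> (l - j) \<theta>)\<close> is real,
  that is, that the image and its reflection have the same moment at \<open>(j, l)\<close>. Finitely
  supported functions with equal moments coincide: already the power moments with \<open>l = 0\<close>
  determine the integral of every polynomial, and the polynomial vanishing at all points of the
  support but one isolates the value there.
\<close>

lemma sum_powers_eq_0_imp_eq_0:
  fixes g :: "'a::idom \<Rightarrow> 'a"
  assumes fin: "finite T" and moments: "\<And>j. (\<Sum>w\<in>T. w ^ j * g w) = 0" and v: "v \<in> T"
  shows "g v = 0"
proof -
  have poly_0: "(\<Sum>w\<in>T. poly p w * g w) = 0" for p
  proof -
    have "(\<Sum>w\<in>T. poly p w * g w) = (\<Sum>w\<in>T. \<Sum>j\<le>degree p. coeff p j * (w ^ j * g w))"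
      by (simp add: poly_altdef sum_distrib_right mult.assoc)
    also have "\<dots> = (\<Sum>j\<le>degree p. coeff p j * (\<Sum>w\<in>T. w ^ j * g w))"
      by (subst sum.swap) (simp add: sum_distrib_left)
    finally show ?thesis
      by (simp add: moments)
  qed
  define p where "p = (\<Prod>u\<in>T - {v}. [:- u, 1:])"
  have "poly p w = 0" if "w \<in> T - {v}" for w
    using that fin by (auto simp: p_def poly_prod intro!: prod_zero)
  then have "(\<Sum>w\<in>T. poly p w * g w) = poly p v * g v"
    by (simp add: sum.remove[OF fin v])
  moreover have "poly p v \<noteq> 0"
    using fin by (auto simp: p_def poly_prod)
  ultimately show ?thesis
    using poly_0[of p] by simp
qed

definition reflect :: "real \<Rightarrow> complex \<Rightarrow> complex" where
  "reflect \<theta> w = cnj w * cis (2 * \<theta>)"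

lemma reflect_reflect [simp]: "reflect \<theta> (reflect \<theta> w) = w"
  by (simp add: reflect_def cis_cnj mult.assoc cis_mult)

lemma reflect_image_eq: "reflect_image \<theta> I = (\<lambda>(w, r). (reflect \<theta> w, r)) ` I"
  by (simp add: reflect_image_def reflect_def cis_conv_exp mult_ac)

text \<open>The cut-off discards the arbitrary values of \<open>\<rho>\<close> away from the pixels.
  With 0 as default, black pixels and background become indistinguishable.\<close>

definition intensity :: "nat \<Rightarrow> (nat \<Rightarrow> complex) \<Rightarrow> (complex \<Rightarrow> real) \<Rightarrow> complex \<Rightarrow> real" where
  "intensity N z \<rho> w = (if w \<in> z ` {1..N} then \<rho> w else 0)"

lemma nonblack_gray_image:
  "nonblack (gray_image N z \<rho>) = {(w, r). r = intensity N z \<rho> w \<and> r \<noteq> 0}"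
  by (fastforce simp: nonblack_def gray_image_def intensity_def split: if_splits)

text \<open>Since \<open>reflect \<theta>\<close> is an involution, the image of a set under it is
  also its preimage.\<close>

lemma nonblack_reflect_image:
  "nonblack (reflect_image \<theta> I) = {(w, r). (reflect \<theta> w, r) \<in> nonblack I}"
  by (force simp: nonblack_def reflect_image_eq)

text \<open>The nonblack part is the graph of the intensity over its support, and the function is
  recovered from it by filling in 0.\<close>

lemma reflection_symmetric_mod_black_iff_intensity:
  "reflection_symmetric_mod_black \<theta> (gray_image N z \<rho>) \<longleftrightarrow>
     (\<forall>w. intensity N z \<rho> (reflect \<theta> w) = intensity N z \<rho> w)"
  unfolding reflection_symmetric_mod_black_def nonblack_reflect_image nonblack_gray_image
  by (auto simp: set_eq_iff) metis

text \<open>The freedom in \<open>T\<close> allows the image and its reflection to be summed over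
  one common set; the added points contribute 0.\<close>

lemma complex_moment_eq_sum_intensity:
  assumes "inj_on z {1..N}" "finite T" "z ` {1..N} \<subseteq> T"
  shows "complex_moment N z \<rho> j l = (\<Sum>w\<in>T. w ^ j * cnj w ^ l * of_real (intensity N z \<rho> w))"
proof -
  have "complex_moment N z \<rho> j l
      = (\<Sum>w\<in>z ` {1..N}. w ^ j * cnj w ^ l * of_real (intensity N z \<rho> w))"
    by (simp add: complex_moment_def intensity_def sum.reindex[OF assms(1)] del: One_nat_def)
  also have "\<dots> = (\<Sum>w\<in>T. w ^ j * cnj w ^ l * of_real (intensity N z \<rho> w))"
    using assms by (intro sum.mono_neutral_left) (auto simp: intensity_def)
  finally show ?thesis .
qed

lemma sum_reflect:
  assumes "reflect \<theta> ` T = T"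
  shows "(\<Sum>w\<in>T. h (reflect \<theta> w)) = (\<Sum>w\<in>T. h w)"
  by (rule sum.reindex_bij_betw) (metis assms bij_betw_def inj_on_inverseI reflect_reflect)

lemma reflect_monomial:
  "reflect \<theta> w ^ j * cnj (reflect \<theta> w) ^ l
     = cis (2 * (real j - real l) * \<theta>) * cnj (w ^ j * cnj w ^ l)"
proof -
  have "cis (2 * \<theta>) ^ j * cis (- (2 * \<theta>)) ^ l = cis (2 * (real j - real l) * \<theta>)"
    by (simp add: Complex.DeMoivre cis_mult algebra_simps)
  then show ?thesis
    by (simp add: reflect_def cis_cnj power_mult_distrib mult_ac)
qed

text \<open>Substituting \<open>reflect \<theta> w\<close> for \<open>w\<close> moves the reflection
  from the intensity to the monomial. There it acts as conjugation and a constant phase, and both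
  leave the sum because intensities are real.\<close>

lemma reflected_moment:
  assumes "inj_on z {1..N}" "finite T" "z ` {1..N} \<subseteq> T" "reflect \<theta> ` T = T"
  shows "(\<Sum>w\<in>T. w ^ j * cnj w ^ l * of_real (intensity N z \<rho> (reflect \<theta> w)))
           = cis (2 * (real j - real l) * \<theta>) * cnj (complex_moment N z \<rho> j l)"
proof -
  have "(\<Sum>w\<in>T. w ^ j * cnj w ^ l * of_real (intensity N z \<rho> (reflect \<theta> w)))
      = (\<Sum>w\<in>T. reflect \<theta> w ^ j * cnj (reflect \<theta> w) ^ l * of_real (intensity N z \<rho> w))"
    by (subst sum_reflect[OF assms(4), symmetric]) simp
  also have "\<dots> = cis (2 * (real j - real l) * \<theta>) * cnj (complex_moment N z \<rho> j l)"
    unfolding complex_moment_eq_sum_intensity[OF assms(1-3)] reflect_monomial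
    by (simp add: sum_distrib_left mult_ac)
  finally show ?thesis .
qed

lemma tan_eq_quotient_iff_cnj:
  "tan_eq_quotient \<phi> (- Im m) (Re m) \<longleftrightarrow> cis (- (2 * \<phi>)) * cnj m = m"
proof -
  \<comment> \<open>Cross-multiplied, the condition is
    \<open>Im (cis \<phi> * m) = 0\<close>.\<close>
  have "tan_eq_quotient \<phi> (- Im m) (Re m) \<longleftrightarrow> cnj (cis \<phi> * m) = cis \<phi> * m"
    by (auto simp: tan_eq_quotient_iff complex_eq_iff algebra_simps)
  also have "\<dots> \<longleftrightarrow> cis (- \<phi>) * cnj (cis \<phi> * m) = cis (- \<phi>) * (cis \<phi> * m)"
    by simp
  also have "\<dots> \<longleftrightarrow> cis (- (2 * \<phi>)) * cnj m = m"
    by (simp add: cis_cnj mult.assoc[symmetric] cis_mult)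
  finally show ?thesis .
qed

lemma reflection_symmetric_mod_black_iff_moments:
  assumes inj: "inj_on z {1..N}"
  shows "reflection_symmetric_mod_black \<theta> (gray_image N z \<rho>) \<longleftrightarrow>
           (\<forall>j l. tan_eq_quotient ((real l - real j) * \<theta>)
                    (- Im (complex_moment N z \<rho> j l)) (Re (complex_moment N z \<rho> j l)))"
proof -
  let ?f = "intensity N z \<rho>" and ?R = "reflect \<theta>"
  \<comment> \<open>The pixels with their mirror points: a finite set that the reflection maps onto
    itself.\<close>
  define T where "T = z ` {1..N} \<union> ?R ` z ` {1..N}"
  have T: "finite T" "z ` {1..N} \<subseteq> T" "?R ` T = T"
    by (auto simp: T_def image_Un image_image)
  note moment = complex_moment_eq_sum_intensity[OF inj T(1,2)]
  have tan_iff: "tan_eq_quotient ((real l - real j) * \<theta>)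
          (- Im (complex_moment N z \<rho> j l)) (Re (complex_moment N z \<rho> j l)) \<longleftrightarrow>
        (\<Sum>w\<in>T. w ^ j * cnj w ^ l * of_real (?f (?R w)))
          = (\<Sum>w\<in>T. w ^ j * cnj w ^ l * of_real (?f w))" for j l
  proof -
    have "- (2 * ((real l - real j) * \<theta>)) = 2 * (real j - real l) * \<theta>"
      by (simp add: algebra_simps)
    then show ?thesis
      by (simp only: tan_eq_quotient_iff_cnj reflected_moment[OF inj T] moment)
  qed
  show ?thesis
    unfolding reflection_symmetric_mod_black_iff_intensity tan_iff
  proof
    assume "\<forall>j l. (\<Sum>w\<in>T. w ^ j * cnj w ^ l * of_real (?f (?R w)))
                = (\<Sum>w\<in>T. w ^ j * cnj w ^ l * of_real (?f w))"
    \<comment> \<open>Taking \<open>l = 0\<close> removes the conjugated factor and leaves pure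
      powers of \<open>w\<close>.\<close>
    from spec[OF spec[OF this], of _ 0]
    have "(\<Sum>w\<in>T. w ^ j * (of_real (?f (?R w)) - of_real (?f w))) = 0" for j
      by (simp add: right_diff_distrib sum_subtractf)
    from sum_powers_eq_0_imp_eq_0[OF T(1) this]
    have "?f (?R w) = ?f w" if "w \<in> T" for w
      using that by simp
    \<comment> \<open>Off \<open>T\<close>, neither \<open>w\<close> nor its mirror point is a
      pixel, so both intensities are 0.\<close>
    moreover have "?f (?R w) = ?f w" if "w \<notin> T" for w
    proof -
      have "?R w \<notin> T"
        using that T(3) by (metis image_eqI reflect_reflect)
      then show ?thesis
        using that T(2) by (auto simp: intensity_def)
    qed
    ultimately show "\<forall>w. ?f (?R w) = ?f w"
      by blast
  qed simp
qed

theorem lemma13: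
  fixes N :: nat and z :: "nat \<Rightarrow> complex" and \<rho> :: "complex \<Rightarrow> real" and \<theta>\<^sub>0 :: real
  assumes "is_gray_image N z \<rho>"
    and "- (pi / 2) < \<theta>\<^sub>0" and "\<theta>\<^sub>0 \<le> pi / 2"
  shows "(reflection_symmetric_mod_black \<theta>\<^sub>0 (gray_image N z \<rho>) \<longleftrightarrow>
           (\<forall>j l. tan_eq_quotient ((real l - real j) * \<theta>\<^sub>0)
                    (- Im (complex_moment N z \<rho> j l)) (Re (complex_moment N z \<rho> j l)))) \<and>
         ((\<forall>k\<in>{1..N}. 0 < \<rho> (z k)) \<longrightarrow>
           (reflection_symmetric \<theta>\<^sub>0 (gray_image N z \<rho>) \<longleftrightarrow>
             (\<forall>j l. tan_eq_quotient ((real l - real j) * \<theta>\<^sub>0)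
                      (- Im (complex_moment N z \<rho> j l)) (Re (complex_moment N z \<rho> j l)))))"
proof -
  from assms(1) have "inj_on z {1..N}"
    by (simp add: is_gray_image_def)
  note iff = reflection_symmetric_mod_black_iff_moments[OF this]
  \<comment> \<open>Positive intensities leave no black pixel, so identifying black with the
    background changes nothing.\<close>
  have "reflection_symmetric_mod_black \<theta>\<^sub>0 (gray_image N z \<rho>)
          \<longleftrightarrow> reflection_symmetric \<theta>\<^sub>0 (gray_image N z \<rho>)" if "\<forall>k\<in>{1..N}. 0 < \<rho> (z k)"
    using that by (intro reflection_symmetric_mod_black_iff) (force simp: gray_image_def)
  with iff show ?thesis
    by blast
qed

end
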